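(* Let $\mathfrak{h}_6$ be the $6$-dimensional nilpotent Lie algebra whose dual has a basis $\{\beta^1,\ldots,\beta^6\}$ with $d\beta^1=d\beta^2=d\beta^3=d\beta^4=0$, $d\beta^5=\beta^1\wedge\beta^2$, $d\beta^6=\beta^1\wedge\beta^3$. For real $t\neq0$ and $\vartheta\in\mathbb{R}$ let $(F_t^\vartheta,\Psi_t^\vartheta)$ be the half-flat $SU(3)$ structure on $\mathfrak{h}_6$ given by $$F_t^\vartheta=\beta^{14}+\cos\vartheta\,\beta^{23}+2t\sin\vartheta\,\beta^{25}-2t\sin\vartheta\,\beta^{36}+4t^2\cos\vartheta\,\beta^{56},$$ $$\Psi_t^\vartheta=(\beta^1+i\,\beta^4)\wedge(\beta^2+i\cos\vartheta\,\beta^3+2t\,i\sin\vartheta\,\beta^5)\wedge(-\sin\vartheta\,\beta^3+2t\cos\vartheta\,\beta^5+2t\,i\,\beta^6).$$ Then for any $\vartheta\in(0,\frac\pi2)$ the half-flat structure $(F_t^\vartheta,\Psi_t^\vartheta)$ solves neither the SUSY equations IIA nor the SUSY equations IIB. Therefore, solutions to the SUSY equations IIA or IIB in general are not stable by small deformations inside the class of half-flat structures (that is, there are curves of half-flat structures starting at a structure that solves IIA, resp. IIB, whose other nearby members do not solve the respective equations).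
   Context: Write $\beta^{ij}=\beta^i\wedge\beta^j$; $d$ is the Chevalley–Eilenberg differential, equivalently forms are left-invariant forms on a nilmanifold with Lie algebra $\mathfrak{h}_6$. An $SU(3)$ structure $(F,\Psi)$ consists of an almost Hermitian structure $(J,g)$ with fundamental $2$-form $F(X,Y)=g(JX,Y)$ and a $(3,0)$-form $\Psi$ with $F\wedge\Psi=0$ and $\frac43F^3=i\,\Psi\wedge\overline\Psi\neq0$. It is half-flat if $d(F\wedge F)=0$ and $d(Re(\Psi))=0$. To $(F_t^\vartheta,\Psi_t^\vartheta)$ one associates the forms $$\hat\alpha=\beta^1+i\,\beta^4,\qquad \hat\omega=F_t^\vartheta-\beta^{14},\qquad \hat\Omega=(\beta^2+i\cos\vartheta\,\beta^3+2t\,i\sin\vartheta\,\beta^5)\wedge(-\sin\vartheta\,\beta^3+2t\cos\vartheta\,\beta^5+2t\,i\,\beta^6),$$ so that $F_t^\vartheta=\hat\omega+\frac i2\hat\alpha\wedge\overline{\hat\alpha}$ and $\Psi_t^\vartheta=\hat\alpha\wedge\hat\Omega$. Let $k_{||},k_\perp\in(0,1)$ be constants with $k_{||}^2+k_\perp^2=1$. The structure solves the SUSY equations IIA if, for some such $k_{||},k_\perp$, the forms $\alpha,Re(\Omega)_{||},Re(\Omega)_\perp,Im(\Omega)$ defined by $$Re(\alpha)+i\,k_{||}Im(\alpha)=\hat\alpha,\qquad \frac1{k_\perp}Re(\Omega)_\perp=\hat\omega,\qquad Im(\Omega)-i\,\frac1{k_{||}}Re(\Omega)_{||}=\hat\Omega$$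 satisfy, for the $3$-form $H$ determined by the second equation, $$d(Re(\alpha))=0,\qquad k_{||}H=k_\perp d(Im(\Omega)),\qquad d(Re(\Omega)_\perp)=k_{||}k_\perp Re(\alpha)\wedge d(Im(\alpha)),$$ $$H\wedge Re(\alpha)=-\frac{k_\perp}{k_{||}}\,d\big(Im(\alpha)\wedge Re(\Omega)_{||}\big).$$ The structure solves the SUSY equations IIB if, for some such $k_{||},k_\perp$, the forms $\alpha,Re(\Omega)_{||},Re(\Omega)_\perp,Im(\Omega)$ defined by $$k_{||}Re(\alpha)+i\,Im(\alpha)=\hat\alpha,\qquad \frac1{k_\perp}Re(\Omega)_{||}=\hat\omega,\qquad \frac1{k_{||}}Re(\Omega)_\perp+i\,Im(\Omega)=\hat\Omega$$ satisfy, for the $3$-form $H$ determined by the third equation, $$d(Re(\alpha))=0,\qquad d(Im(\alpha))=0,\qquad k_{||}H=k_\perp d(Im(\Omega)),$$ $$Re(\alpha)\wedge H=-\frac{k_\perp}{k_{||}}Im(\alpha)\wedge d(Re(\Omega)_\perp),\qquad Im(\alpha)\wedge H=\frac{k_\perp}{k_{||}}Re(\alpha)\wedge d(Re(\Omega)_\perp),$$ $$Re(\alpha)\wedge Im(\alpha)\wedge d(Re(\Omega)_{||})=-H\wedge Im(\Omega).$$ *)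

theory Defs
  imports "HOL-Analysis.Analysis"
begin

section \<open>Complex exterior forms on a Lie algebra with an ordered basis\<close>

text \<open>
  The complexified exterior algebra on the basis \<open>\<beta>\<^sup>i\<close> of the dual of \<open>real ^ 'n\<close>.
  A form is the vector of its coefficients: \<open>\<phi> $ S\<close> is the coefficient of the basis
  element \<open>\<beta>\<^sup>S = \<beta>\<^sup>i \<and> \<beta>\<^sup>j \<and> \<dots>\<close>, where \<open>S = {i < j < \<dots>}\<close>.
\<close>

type_synonym 'n form = "complex ^ 'n set"

definition basis_form :: "'n::finite set \<Rightarrow> 'n form" where
  "basis_form S = axis S 1"

abbreviation covec :: "'n::finite \<Rightarrow> 'n form" ("\<beta>") where
  "\<beta> i \<equiv> basis_form {i}"

definition homogeneous :: "nat \<Rightarrow> 'n::finite form \<Rightarrow> bool" where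
  "homogeneous k \<phi> \<longleftrightarrow> (\<forall>S. card S \<noteq> k \<longrightarrow> \<phi> $ S = 0)"

text \<open>\<open>\<beta>\<^sup>S \<and> \<beta>\<^sup>T = shuffle_sign S T \<cdot> \<beta>\<^bsup>S \<union> T\<^esup>\<close> for disjoint \<open>S\<close> and \<open>T\<close>.\<close>

definition shuffle_sign :: "'n::{finite,linorder} set \<Rightarrow> 'n set \<Rightarrow> complex" where
  "shuffle_sign S T = (-1) ^ card {(i, j). i \<in> S \<and> j \<in> T \<and> j < i}"

definition wedge :: "'n::{finite,linorder} form \<Rightarrow> 'n form \<Rightarrow> 'n form" (infixr "\<^bold>\<and>" 75) where
  "\<phi> \<^bold>\<and> \<psi> = (\<chi> U. \<Sum>S\<in>Pow U. shuffle_sign S (U - S) * \<phi> $ S * \<psi> $ (U - S))"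

definition form_cnj :: "'n::finite form \<Rightarrow> 'n form" where
  "form_cnj \<phi> = (\<chi> S. cnj (\<phi> $ S))"

definition form_Re :: "'n::finite form \<Rightarrow> 'n form" where
  "form_Re \<phi> = (\<chi> S. complex_of_real (Re (\<phi> $ S)))"

definition form_Im :: "'n::finite form \<Rightarrow> 'n form" where
  "form_Im \<phi> = (\<chi> S. complex_of_real (Im (\<phi> $ S)))"

definition real_form :: "'n::finite form \<Rightarrow> bool" where
  "real_form \<phi> \<longleftrightarrow> form_cnj \<phi> = \<phi>"

text \<open>Evaluation of forms of degree 1 and 2, with
  \<open>(\<beta>\<^sup>i \<and> \<beta>\<^sup>j)(X, Y) = X\<^sub>i Y\<^sub>j - X\<^sub>j Y\<^sub>i\<close>.\<close>

definition eval1 :: "'n::finite form \<Rightarrow> real ^ 'n \<Rightarrow> complex" where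
  "eval1 \<phi> X = (\<Sum>i\<in>UNIV. \<phi> $ {i} * complex_of_real (X $ i))"

definition eval2 :: "'n::{finite,linorder} form \<Rightarrow> (real, 'n) vec \<Rightarrow> (real, 'n) vec \<Rightarrow> complex" where
  "eval2 \<phi> X Y =
    (\<Sum>i\<in>UNIV. \<Sum>j\<in>{i<..}. \<phi> $ {i, j} * complex_of_real (X $ i * Y $ j - X $ j * Y $ i))"

definition lie_bracket :: "('a::real_vector \<Rightarrow> 'a \<Rightarrow> 'a) \<Rightarrow> bool" where
  "lie_bracket br \<longleftrightarrow> bilinear br \<and> (\<forall>X. br X X = 0) \<and>
     (\<forall>X Y Z. br X (br Y Z) + br Y (br Z X) + br Z (br X Y) = 0)"

text \<open>
  The Chevalley--Eilenberg differential: on covectors \<open>d\<beta>(X, Y) = - \<beta>([X, Y])\<close>, extended to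
  all forms as the complex-linear antiderivation. As \<open>d\<beta>\<^sup>i\<close> has even degree it can be
  moved to the front of the product, which gives
  \<open>d(\<beta>\<^sup>S) = \<Sum>i\<in>S. (-1)\<^bsup>#{j\<in>S. j < i}\<^esup> d\<beta>\<^sup>i \<and> \<beta>\<^bsup>S - {i}\<^esup>\<close>.
\<close>

definition CE_covec ::
  "((real, 'n::{finite,linorder}) vec \<Rightarrow> (real, 'n) vec \<Rightarrow> (real, 'n) vec) \<Rightarrow> 'n \<Rightarrow> 'n form" where
  "CE_covec br k = - (\<Sum>i\<in>UNIV. \<Sum>j\<in>{i<..}. (br (axis i 1) (axis j 1) $ k) *\<^sub>R (\<beta> i \<^bold>\<and> \<beta> j))"

definition CE_diff ::
  "((real, 'n::{finite,linorder}) vec \<Rightarrow> (real, 'n) vec \<Rightarrow> (real, 'n) vec) \<Rightarrow> 'n form \<Rightarrow> 'n form" where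
  "CE_diff br \<phi> = (\<Sum>S\<in>UNIV. \<phi> $ S *s
     (\<Sum>i\<in>S. (-1) ^ card {j \<in> S. j < i} *s (CE_covec br i \<^bold>\<and> basis_form (S - {i}))))"


section \<open>Half-flat SU(3) structures on a six-dimensional Lie algebra\<close>

datatype ix = I1 | I2 | I3 | I4 | I5 | I6

lemma UNIV_ix: "UNIV = {I1, I2, I3, I4, I5, I6}"
  using ix.exhaust by auto

instance ix :: finite
  by standard (simp add: UNIV_ix)

fun ix_nat :: "ix \<Rightarrow> nat" where
  "ix_nat I1 = 1" | "ix_nat I2 = 2" | "ix_nat I3 = 3"
| "ix_nat I4 = 4" | "ix_nat I5 = 5" | "ix_nat I6 = 6"

instantiation ix :: linorder
begin

definition "i \<le> j \<longleftrightarrow> ix_nat i \<le> ix_nat j"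
definition "i < j \<longleftrightarrow> ix_nat i < ix_nat j"

instance
proof
  fix i j :: ix
  show "i \<le> j \<Longrightarrow> j \<le> i \<Longrightarrow> i = j"
    by (cases i; cases j) (simp_all add: less_eq_ix_def)
qed (auto simp: less_eq_ix_def less_ix_def)

end

definition inner_prod :: "(real ^ ix \<Rightarrow> real ^ ix \<Rightarrow> real) \<Rightarrow> bool" where
  "inner_prod g \<longleftrightarrow> bilinear g \<and> (\<forall>X Y. g X Y = g Y X) \<and> (\<forall>X. X \<noteq> 0 \<longrightarrow> g X X > 0)"

definition almost_hermitian ::
  "(real ^ ix \<Rightarrow> real ^ ix) \<Rightarrow> (real ^ ix \<Rightarrow> real ^ ix \<Rightarrow> real) \<Rightarrow> bool" where
  "almost_hermitian J g \<longleftrightarrow> linear J \<and> (\<forall>X. J (J X) = - X) \<and> inner_prod g \<and>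
     (\<forall>X Y. g (J X) (J Y) = g X Y)"

definition fundamental_form ::
  "(real ^ ix \<Rightarrow> real ^ ix) \<Rightarrow> (real ^ ix \<Rightarrow> real ^ ix \<Rightarrow> real) \<Rightarrow> ix form \<Rightarrow> bool" where
  "fundamental_form J g F \<longleftrightarrow> homogeneous 2 F \<and>
     (\<forall>X Y. eval2 F X Y = complex_of_real (g (J X) Y))"

definition form_10 :: "(real ^ ix \<Rightarrow> real ^ ix) \<Rightarrow> ix form \<Rightarrow> bool" where
  "form_10 J a \<longleftrightarrow> homogeneous 1 a \<and> (\<forall>X. eval1 a (J X) = \<i> * eval1 a X)"

text \<open>The real span below is the complex span, since the spanning set is closed under
  multiplication by complex scalars.\<close>

definition form_30 :: "(real ^ ix \<Rightarrow> real ^ ix) \<Rightarrow> ix form \<Rightarrow> bool" where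
  "form_30 J \<Psi> \<longleftrightarrow>
     \<Psi> \<in> span {a \<^bold>\<and> b \<^bold>\<and> c | a b c. form_10 J a \<and> form_10 J b \<and> form_10 J c}"

definition SU3_structure :: "ix form \<Rightarrow> ix form \<Rightarrow> bool" where
  "SU3_structure F \<Psi> \<longleftrightarrow>
     (\<exists>J g. almost_hermitian J g \<and> fundamental_form J g F \<and> form_30 J \<Psi>) \<and>
     F \<^bold>\<and> \<Psi> = 0 \<and>
     (4/3) *\<^sub>R (F \<^bold>\<and> F \<^bold>\<and> F) = \<i> *s (\<Psi> \<^bold>\<and> form_cnj \<Psi>) \<and>
     \<i> *s (\<Psi> \<^bold>\<and> form_cnj \<Psi>) \<noteq> 0"

definition half_flat ::
  "(real ^ ix \<Rightarrow> real ^ ix \<Rightarrow> real ^ ix) \<Rightarrow> ix form \<Rightarrow> ix form \<Rightarrow> bool" where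
  "half_flat br F \<Psi> \<longleftrightarrow> SU3_structure F \<Psi> \<and>
     CE_diff br (F \<^bold>\<and> F) = 0 \<and> CE_diff br (form_Re \<Psi>) = 0"


section \<open>The SUSY equations\<close>

text \<open>
  The arguments \<open>a\<close>, \<open>w\<close>, \<open>Om\<close> are the forms written with a hat in the literature; \<open>kp\<close>, \<open>ko\<close>
  are the parallel and orthogonal constants, and \<open>RO_p\<close>, \<open>RO_o\<close> the parallel and orthogonal
  parts of the real part of the complex 2-form, \<open>IO\<close> its imaginary part. Since the latter
  are real, they and \<open>\<alpha>\<close> are uniquely determined by \<open>a\<close>, \<open>w\<close>, \<open>Om\<close>, \<open>kp\<close>, \<open>ko\<close>.
\<close>

definition SUSY_IIA ::
  "(real ^ ix \<Rightarrow> real ^ ix \<Rightarrow> real ^ ix) \<Rightarrow> ix form \<Rightarrow> ix form \<Rightarrow> ix form \<Rightarrow> bool" where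
  "SUSY_IIA br a w Om \<longleftrightarrow>
    (\<exists>kp ko :: real. 0 < kp \<and> kp < 1 \<and> 0 < ko \<and> ko < 1 \<and> kp\<^sup>2 + ko\<^sup>2 = 1 \<and>
     (\<exists>\<alpha> RO_p RO_o IO H.
        real_form RO_p \<and> real_form RO_o \<and> real_form IO \<and>
        form_Re \<alpha> + (\<i> * complex_of_real kp) *s form_Im \<alpha> = a \<and>
        (1 / ko) *\<^sub>R RO_o = w \<and>
        IO - (\<i> * complex_of_real (1 / kp)) *s RO_p = Om \<and>
        CE_diff br (form_Re \<alpha>) = 0 \<and>
        kp *\<^sub>R H = ko *\<^sub>R CE_diff br IO \<and>
        CE_diff br RO_o = (kp * ko) *\<^sub>R (form_Re \<alpha> \<^bold>\<and> CE_diff br (form_Im \<alpha>)) \<and>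
        H \<^bold>\<and> form_Re \<alpha> = - (ko / kp) *\<^sub>R CE_diff br (form_Im \<alpha> \<^bold>\<and> RO_p)))"

definition SUSY_IIB ::
  "(real ^ ix \<Rightarrow> real ^ ix \<Rightarrow> real ^ ix) \<Rightarrow> ix form \<Rightarrow> ix form \<Rightarrow> ix form \<Rightarrow> bool" where
  "SUSY_IIB br a w Om \<longleftrightarrow>
    (\<exists>kp ko :: real. 0 < kp \<and> kp < 1 \<and> 0 < ko \<and> ko < 1 \<and> kp\<^sup>2 + ko\<^sup>2 = 1 \<and>
     (\<exists>\<alpha> RO_p RO_o IO H.
        real_form RO_p \<and> real_form RO_o \<and> real_form IO \<and>
        kp *\<^sub>R form_Re \<alpha> + \<i> *s form_Im \<alpha> = a \<and>
        (1 / ko) *\<^sub>R RO_p = w \<and>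
        (1 / kp) *\<^sub>R RO_o + \<i> *s IO = Om \<and>
        CE_diff br (form_Re \<alpha>) = 0 \<and>
        CE_diff br (form_Im \<alpha>) = 0 \<and>
        kp *\<^sub>R H = ko *\<^sub>R CE_diff br IO \<and>
        form_Re \<alpha> \<^bold>\<and> H = - (ko / kp) *\<^sub>R (form_Im \<alpha> \<^bold>\<and> CE_diff br RO_o) \<and>
        form_Im \<alpha> \<^bold>\<and> H = (ko / kp) *\<^sub>R (form_Re \<alpha> \<^bold>\<and> CE_diff br RO_o) \<and>
        form_Re \<alpha> \<^bold>\<and> form_Im \<alpha> \<^bold>\<and> CE_diff br RO_p = - (H \<^bold>\<and> IO)))"


section \<open>The Lie algebra \<open>\<hh>\<^sub>6\<close> and its family of structures\<close>

text \<open>The bracket is written in the basis dual to \<open>\<beta>\<^sup>1, \<dots>, \<beta>\<^sup>6\<close>: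
  \<open>[e\<^sub>1, e\<^sub>2] = - e\<^sub>5\<close> and \<open>[e\<^sub>1, e\<^sub>3] = - e\<^sub>6\<close>.
  The structure equations are \<open>h6_structure_equations\<close> below.\<close>

definition h6 :: "real ^ ix \<Rightarrow> real ^ ix \<Rightarrow> real ^ ix" where
  "h6 X Y = - (X $ I1 * Y $ I2 - X $ I2 * Y $ I1) *\<^sub>R axis I5 1
            - (X $ I1 * Y $ I3 - X $ I3 * Y $ I1) *\<^sub>R axis I6 1"

lemma h6_two_step: "h6 X (h6 Y Z) = 0"
  by (simp add: h6_def axis_def)

lemma lie_bracket_h6: "lie_bracket h6"
  unfolding lie_bracket_def
proof (intro conjI allI)
  show "bilinear h6"
    unfolding bilinear_def
    by (intro conjI allI linearI) (simp_all add: h6_def vec_eq_iff algebra_simps)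
qed (simp_all add: h6_two_step, simp add: h6_def)

lemma wedge_basis_empty: "\<phi> \<^bold>\<and> basis_form {} = (\<phi> :: 'n::{finite,linorder} form)"
proof -
  have "(\<Sum>S\<in>Pow U. shuffle_sign S (U - S) * \<phi> $ S * basis_form {} $ (U - S)) = \<phi> $ U" for U
  proof -
    have [simp]: "{(i, j). i \<in> U \<and> j \<in> U \<and> j \<notin> U \<and> j < i} = {}" by auto
    have "(\<Sum>S\<in>Pow U. shuffle_sign S (U - S) * \<phi> $ S * basis_form {} $ (U - S)) =
        (\<Sum>S\<in>Pow U. if S = U then \<phi> $ U else 0)"
      by (rule sum.cong) (auto simp: basis_form_def axis_def shuffle_sign_def)
    then show ?thesis by simp
  qed
  then show ?thesis by (simp add: wedge_def vec_eq_iff)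
qed

lemma CE_diff_covec: "CE_diff br (\<beta> k) = CE_covec br (k :: 'n::{finite,linorder})"
proof -
  have [simp]: "{j. j = k \<and> j < k} = {}" by auto
  have "CE_diff br (\<beta> k) = (\<Sum>S\<in>UNIV. if S = {k} then CE_covec br k else 0)"
    unfolding CE_diff_def
    by (rule sum.cong) (auto simp: basis_form_def axis_def wedge_basis_empty[unfolded basis_form_def axis_def])
  then show ?thesis by simp
qed

lemma h6_structure_equations:
  "CE_diff h6 (\<beta> I1) = 0" "CE_diff h6 (\<beta> I2) = 0" "CE_diff h6 (\<beta> I3) = 0" "CE_diff h6 (\<beta> I4) = 0"
  "CE_diff h6 (\<beta> I5) = \<beta> I1 \<^bold>\<and> \<beta> I2" "CE_diff h6 (\<beta> I6) = \<beta> I1 \<^bold>\<and> \<beta> I3"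
proof -
  have I: "{I1<..} = {I2, I3, I4, I5, I6}" "{I2<..} = {I3, I4, I5, I6}"
    "{I3<..} = {I4, I5, I6}" "{I4<..} = {I5, I6}" "{I5<..} = {I6}" "{I6<..} = {}"
    by (auto simp: less_ix_def, (case_tac x; simp)+)
  note simps = CE_diff_covec CE_covec_def UNIV_ix I h6_def axis_def
  show "CE_diff h6 (\<beta> I1) = 0" "CE_diff h6 (\<beta> I2) = 0" "CE_diff h6 (\<beta> I3) = 0" "CE_diff h6 (\<beta> I4) = 0"
    "CE_diff h6 (\<beta> I5) = \<beta> I1 \<^bold>\<and> \<beta> I2" "CE_diff h6 (\<beta> I6) = \<beta> I1 \<^bold>\<and> \<beta> I3"
    by (simp_all add: simps)
qed

definition F_fam :: "real \<Rightarrow> real \<Rightarrow> ix form" where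
  "F_fam t \<theta> = \<beta> I1 \<^bold>\<and> \<beta> I4 + cos \<theta> *\<^sub>R (\<beta> I2 \<^bold>\<and> \<beta> I3) + (2 * t * sin \<theta>) *\<^sub>R (\<beta> I2 \<^bold>\<and> \<beta> I5)
     - (2 * t * sin \<theta>) *\<^sub>R (\<beta> I3 \<^bold>\<and> \<beta> I6) + (4 * t\<^sup>2 * cos \<theta>) *\<^sub>R (\<beta> I5 \<^bold>\<and> \<beta> I6)"

definition Psi_fam :: "real \<Rightarrow> real \<Rightarrow> ix form" where
  "Psi_fam t \<theta> =
     (\<beta> I1 + \<i> *s \<beta> I4) \<^bold>\<and>
     (\<beta> I2 + \<i> *s (cos \<theta> *\<^sub>R \<beta> I3) + \<i> *s ((2 * t * sin \<theta>) *\<^sub>R \<beta> I5)) \<^bold>\<and>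
     (- (sin \<theta> *\<^sub>R \<beta> I3) + (2 * t * cos \<theta>) *\<^sub>R \<beta> I5 + \<i> *s ((2 * t) *\<^sub>R \<beta> I6))"

definition alpha_hat :: "ix form" where
  "alpha_hat = \<beta> I1 + \<i> *s \<beta> I4"

definition omega_hat :: "real \<Rightarrow> real \<Rightarrow> ix form" where
  "omega_hat t \<theta> = F_fam t \<theta> - \<beta> I1 \<^bold>\<and> \<beta> I4"

definition Omega_hat :: "real \<Rightarrow> real \<Rightarrow> ix form" where
  "Omega_hat t \<theta> =
     (\<beta> I2 + \<i> *s (cos \<theta> *\<^sub>R \<beta> I3) + \<i> *s ((2 * t * sin \<theta>) *\<^sub>R \<beta> I5)) \<^bold>\<and>
     (- (sin \<theta> *\<^sub>R \<beta> I3) + (2 * t * cos \<theta>) *\<^sub>R \<beta> I5 + \<i> *s ((2 * t) *\<^sub>R \<beta> I6))"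

definition solves_IIA :: "real \<Rightarrow> real \<Rightarrow> bool" where
  "solves_IIA t \<theta> \<longleftrightarrow> SUSY_IIA h6 alpha_hat (omega_hat t \<theta>) (Omega_hat t \<theta>)"

definition solves_IIB :: "real \<Rightarrow> real \<Rightarrow> bool" where
  "solves_IIB t \<theta> \<longleftrightarrow> SUSY_IIB h6 alpha_hat (omega_hat t \<theta>) (Omega_hat t \<theta>)"

text \<open>Infinitely differentiable curves: \<open>D n\<close> is the \<open>n\<close>-th derivative, one-sided at the ends of
  a closed interval.\<close>

definition smooth_curve_on :: "real set \<Rightarrow> (real \<Rightarrow> 'a::real_normed_vector) \<Rightarrow> bool" where
  "smooth_curve_on I c \<longleftrightarrow> (\<exists>D :: nat \<Rightarrow> real \<Rightarrow> 'a. D 0 = c \<and>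
     (\<forall>n. \<forall>s\<in>I. (D n has_vector_derivative D (Suc n) s) (at s within I)))"

end

theory Submission
  imports Defs
begin

text \<open>
  Put \<open>P = \<beta>\<^sup>2\<^sup>3 + 4t\<^sup>2 \<beta>\<^sup>5\<^sup>6\<close> and \<open>Q = 2t (\<beta>\<^sup>2\<^sup>5 - \<beta>\<^sup>3\<^sup>6)\<close>. The angle \<open>\<theta>\<close> merely rotates these two
  real forms: the real form \<open>\<omega>\<close> is \<open>cos \<theta> P + sin \<theta> Q\<close>, the real part of \<open>\<Omega>\<close> is
  \<open>cos \<theta> Q - sin \<theta> P\<close>, and the imaginary part of \<open>\<Omega>\<close> is \<open>2t (\<beta>\<^sup>2\<^sup>6 + \<beta>\<^sup>3\<^sup>5)\<close> for every \<open>\<theta>\<close>. Now \<open>Q\<close> and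
  the imaginary part are closed, whereas \<open>dP = 4t\<^sup>2 d\<beta>\<^sup>5\<^sup>6\<close> does not vanish
  (\<open>d\<beta>\<^sup>5\<^sup>6 = \<beta>\<^sup>1\<^sup>2\<^sup>6 - \<beta>\<^sup>1\<^sup>3\<^sup>5\<close>).

  In system IIA the imaginary part of \<open>\<alpha>\<close> is a multiple of the closed form \<open>\<beta>\<^sup>4\<close>, so the third
  equation forces \<open>d\<omega> = 0\<close>, that is \<open>cos \<theta> = 0\<close>. In system IIB the form \<open>H\<close> is a multiple of
  the differential of the imaginary part of \<open>\<Omega>\<close>, hence zero, and the fourth equation then
  forces \<open>\<beta>\<^sup>4 \<and> d(Re \<Omega>) = 0\<close>, that is \<open>sin \<theta> = 0\<close>. Conversely, in these two
  cases all remaining equations hold, for instance with the constants \<open>3/5\<close> and \<open>4/5\<close>; so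
  \<open>solves_IIA_iff\<close> and \<open>solves_IIB_iff\<close> are equivalences. They exclude the open interval
  \<open>(0, \<pi>/2)\<close>, and its endpoints \<open>\<pi>/2\<close> and \<open>0\<close> are the starting points of the curves
  that show instability.

  That every member of the family is half-flat is seen from the coframe
  \<open>\<beta>\<^sup>1, \<beta>\<^sup>4, \<beta>\<^sup>2, cos \<theta> \<beta>\<^sup>3 + 2t sin \<theta> \<beta>\<^sup>5, - sin \<theta> \<beta>\<^sup>3 + 2t cos \<theta> \<beta>\<^sup>5, 2t \<beta>\<^sup>6\<close>. Declaring it to be
  orthonormal, with consecutive pairs as the real and imaginary parts of (1,0)-forms, defines
  the almost Hermitian structure; the remaining identities are finite computations in the
  exterior algebra, into which \<open>\<theta>\<close> enters only through \<open>cos\<^sup>2 \<theta> + sin\<^sup>2 \<theta> = 1\<close>.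
\<close>

section \<open>Computing in the exterior algebra\<close>

lemma wedge_add_left: "(\<phi> + \<phi>') \<^bold>\<and> \<psi> = \<phi> \<^bold>\<and> \<psi> + \<phi>' \<^bold>\<and> \<psi>"
  and wedge_add_right: "\<phi> \<^bold>\<and> (\<psi> + \<psi>') = \<phi> \<^bold>\<and> \<psi> + \<phi> \<^bold>\<and> \<psi>'"
  by (simp_all add: wedge_def vec_eq_iff sum.distrib algebra_simps)

lemma wedge_diff_left: "(\<phi> - \<phi>') \<^bold>\<and> \<psi> = \<phi> \<^bold>\<and> \<psi> - \<phi>' \<^bold>\<and> \<psi>"
  and wedge_diff_right: "\<phi> \<^bold>\<and> (\<psi> - \<psi>') = \<phi> \<^bold>\<and> \<psi> - \<phi> \<^bold>\<and> \<psi>'"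
  by (simp_all add: wedge_def vec_eq_iff sum_subtractf algebra_simps)

lemma wedge_minus_left: "(- \<phi>) \<^bold>\<and> \<psi> = - (\<phi> \<^bold>\<and> \<psi>)"
  and wedge_minus_right: "\<phi> \<^bold>\<and> (- \<psi>) = - (\<phi> \<^bold>\<and> \<psi>)"
  by (simp_all add: wedge_def vec_eq_iff sum_negf)

lemma wedge_smult_left: "(a *s \<phi>) \<^bold>\<and> \<psi> = a *s (\<phi> \<^bold>\<and> \<psi>)"
  and wedge_smult_right: "\<phi> \<^bold>\<and> (a *s \<psi>) = a *s (\<phi> \<^bold>\<and> \<psi>)"
  by (simp_all add: wedge_def vec_eq_iff sum_distrib_left algebra_simps)

lemma wedge_zero_left: "0 \<^bold>\<and> \<psi> = 0" and wedge_zero_right: "\<psi> \<^bold>\<and> 0 = 0"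
  by (simp_all add: wedge_def vec_eq_iff)

lemma scaleR_form: "r *\<^sub>R \<phi> = complex_of_real r *s (\<phi> :: 'n::finite form)"
  by (simp add: vec_eq_iff scaleR_conv_of_real[where 'a=complex])

lemma wedge_scaleR_left: "(r *\<^sub>R \<phi>) \<^bold>\<and> \<psi> = r *\<^sub>R (\<phi> \<^bold>\<and> \<psi>)"
  and wedge_scaleR_right: "\<phi> \<^bold>\<and> (r *\<^sub>R \<psi>) = r *\<^sub>R (\<phi> \<^bold>\<and> \<psi>)"
  by (simp_all add: scaleR_form wedge_smult_left wedge_smult_right)

lemma basis_form_nth: "basis_form S $ T = (if T = S then 1 else 0)"
  by (simp add: basis_form_def axis_def)

lemma form_eqI: "(\<And>S. \<phi> $ S = \<psi> $ S) \<Longrightarrow> \<phi> = (\<psi> :: 'n::finite form)"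
  by (simp add: vec_eq_iff)

lemma wedge_basis_forms:
  "basis_form S \<^bold>\<and> basis_form T =
    (if S \<inter> T = {} then shuffle_sign S T *s basis_form (S \<union> T) else 0)"
proof -
  have "(\<Sum>R\<in>Pow U. shuffle_sign R (U - R) * basis_form S $ R * basis_form T $ (U - R)) =
      (if S \<subseteq> U \<and> U - S = T then shuffle_sign S T else 0)" for U
  proof -
    have "(\<Sum>R\<in>Pow U. shuffle_sign R (U - R) * basis_form S $ R * basis_form T $ (U - R)) =
        (\<Sum>R\<in>Pow U. if R = S then (if U - S = T then shuffle_sign S T else 0) else 0)"
      by (rule sum.cong) (auto simp: basis_form_def axis_def)
    then show ?thesis by simp
  qed
  moreover have "S \<subseteq> U \<and> U - S = T \<longleftrightarrow> S \<inter> T = {} \<and> U = S \<union> T" for U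
    by auto
  ultimately show ?thesis
    by (simp add: wedge_def vec_eq_iff basis_form_def axis_def)
qed

text \<open>Unlike a cardinality of a set of pairs, a double product is evaluated by the simplifier when
  the index sets are explicit.\<close>

lemma shuffle_sign_prod:
  "shuffle_sign S T = (\<Prod>i\<in>S. \<Prod>j\<in>T. if j < i then - 1 else 1)"
proof -
  have "(\<Prod>i\<in>S. \<Prod>j\<in>T. if j < i then - 1 else (1::complex)) =
      (\<Prod>p\<in>S \<times> T. if p \<in> {(i, j). i \<in> S \<and> j \<in> T \<and> j < i} then - 1 else 1)"
    unfolding prod.cartesian_product by (rule prod.cong) (auto split: if_splits)
  also have "\<dots> = (\<Prod>p\<in>{(i, j). i \<in> S \<and> j \<in> T \<and> j < i}. - 1)"
    by (rule prod.mono_neutral_cong_right) auto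
  finally show ?thesis by (simp add: shuffle_sign_def)
qed

lemma CE_diff_add: "CE_diff br (\<phi> + \<psi>) = CE_diff br \<phi> + CE_diff br \<psi>"
  by (simp add: CE_diff_def vector_sadd_rdistrib sum.distrib)

lemma CE_diff_diff: "CE_diff br (\<phi> - \<psi>) = CE_diff br \<phi> - CE_diff br \<psi>"
  by (simp add: CE_diff_def vec.scale_left_diff_distrib sum_subtractf)

lemma CE_diff_minus: "CE_diff br (- \<phi>) = - CE_diff br \<phi>"
  by (simp add: CE_diff_def sum_negf)

lemma CE_diff_smult: "CE_diff br (a *s \<phi>) = a *s CE_diff br \<phi>"
  by (simp add: CE_diff_def vec.scale_sum_right mult.assoc)

lemma CE_diff_scaleR: "CE_diff br (r *\<^sub>R \<phi>) = r *\<^sub>R CE_diff br \<phi>"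
  by (simp add: scaleR_form CE_diff_smult)

lemma CE_diff_zero: "CE_diff br 0 = 0"
  by (simp add: CE_diff_def)

lemma CE_diff_basis_form:
  "CE_diff br (basis_form S) =
    (\<Sum>i\<in>S. shuffle_sign {i} S *s (CE_covec br i \<^bold>\<and> basis_form (S - {i})))"
proof -
  have card_eq: "card {(i', j). i' \<in> {i} \<and> j \<in> S \<and> j < i'} = card {j \<in> S. j < i}" for i
  proof -
    have "{(i', j). i' \<in> {i} \<and> j \<in> S \<and> j < i'} = Pair i ` {j \<in> S. j < i}" by auto
    then show ?thesis by (simp add: card_image inj_on_def)
  qed
  have "CE_diff br (basis_form S) = (\<Sum>R\<in>UNIV. if R = S then
      (\<Sum>i\<in>S. (-1) ^ card {j \<in> S. j < i} *s (CE_covec br i \<^bold>\<and> basis_form (S - {i}))) else 0)"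
    unfolding CE_diff_def by (rule sum.cong) (auto simp: basis_form_def axis_def)
  then show ?thesis by (simp only: shuffle_sign_def card_eq) simp
qed

text \<open>As a conditional rewrite rule this sorts the elements of an explicit set, so that equal basis
  forms become syntactically equal.\<close>

lemma insert_sort: "j < i \<Longrightarrow> insert i (insert j A) = insert j (insert i A)"
  by (rule insert_commute)

text \<open>Only \<open>\<beta>\<^sup>5\<close> and \<open>\<beta>\<^sup>6\<close> contribute, the other covectors being closed.\<close>

lemma CE_diff_h6_basis_form:
  "CE_diff h6 (basis_form S) =
    (if I5 \<in> S then shuffle_sign {I5} S *s (basis_form {I1, I2} \<^bold>\<and> basis_form (S - {I5})) else 0) +
    (if I6 \<in> S then shuffle_sign {I6} S *s (basis_form {I1, I3} \<^bold>\<and> basis_form (S - {I6})) else 0)"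
proof -
  have dd: "CE_covec h6 I1 = 0" "CE_covec h6 I2 = 0" "CE_covec h6 I3 = 0" "CE_covec h6 I4 = 0"
    "CE_covec h6 I5 = basis_form {I1, I2}" "CE_covec h6 I6 = basis_form {I1, I3}"
    using h6_structure_equations
    by (simp_all add: CE_diff_covec wedge_basis_forms shuffle_sign_prod less_ix_def insert_sort)
  have "CE_diff h6 (basis_form S) = (\<Sum>i\<in>UNIV. if i \<in> S then
      shuffle_sign {i} S *s (CE_covec h6 i \<^bold>\<and> basis_form (S - {i})) else 0)"
    unfolding CE_diff_basis_form by (rule sum.mono_neutral_cong_left) auto
  then show ?thesis
    by (simp add: UNIV_ix dd wedge_zero_left)
qed

text \<open>Adding a form to itself makes the simplifier produce a numeral factor, read as a constant
  vector and multiplied componentwise.\<close>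

lemma numeral_times_form: "numeral n * \<phi> = numeral n *s (\<phi> :: 'n::finite form)"
  by (simp add: vec_eq_iff)

lemmas form_expand = scaleR_form numeral_times_form
  wedge_add_left wedge_add_right wedge_diff_left wedge_diff_right wedge_minus_left wedge_minus_right
  wedge_smult_left wedge_smult_right wedge_zero_left wedge_zero_right
  vec.scale_right_distrib vec.scale_right_diff_distrib
  wedge_basis_forms shuffle_sign_prod less_ix_def insert_sort insert_Diff_if
  CE_diff_add CE_diff_diff CE_diff_minus CE_diff_smult CE_diff_zero CE_diff_h6_basis_form


section \<open>Real and imaginary parts of forms\<close>

lemma form_cnj_simps:
  "form_cnj (\<phi> + \<psi>) = form_cnj \<phi> + form_cnj \<psi>"
  "form_cnj (\<phi> - \<psi>) = form_cnj \<phi> - form_cnj \<psi>"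
  "form_cnj (- \<phi>) = - form_cnj \<phi>"
  "form_cnj (a *s \<phi>) = cnj a *s form_cnj \<phi>"
  "form_cnj (basis_form S) = basis_form S"
  by (simp_all add: form_cnj_def vec_eq_iff basis_form_nth)

lemma real_form_simps:
  "real_form \<phi> \<Longrightarrow> real_form \<psi> \<Longrightarrow> real_form (\<phi> + \<psi>)"
  "real_form \<phi> \<Longrightarrow> real_form \<psi> \<Longrightarrow> real_form (\<phi> - \<psi>)"
  "real_form \<phi> \<Longrightarrow> real_form (- \<phi>)"
  "real_form \<phi> \<Longrightarrow> real_form (r *\<^sub>R \<phi>)"
  "real_form (basis_form S)"
  "real_form (form_Re \<eta>)"
  "real_form (form_Im \<eta>)"
  by (simp_all add: real_form_def form_cnj_def form_Re_def form_Im_def vec_eq_iff basis_form_nth)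

lemma real_form_wedge: "real_form \<phi> \<Longrightarrow> real_form \<psi> \<Longrightarrow> real_form (\<phi> \<^bold>\<and> \<psi>)"
  by (simp add: real_form_def form_cnj_def vec_eq_iff wedge_def shuffle_sign_def)

lemma real_imaginary_parts:
  assumes "real_form \<phi>" "real_form \<psi>"
  shows "form_Re (\<phi> + \<i> *s \<psi>) = \<phi>" "form_Im (\<phi> + \<i> *s \<psi>) = \<psi>"
  using assms
  by (simp_all add: real_form_def form_cnj_def form_Re_def form_Im_def vec_eq_iff complex_eq_iff)

text \<open>This is what determines the unknown forms of the SUSY equations from the given ones.\<close>

lemma real_imaginary_unique:
  assumes "real_form \<phi>" "real_form \<psi>" "real_form \<phi>'" "real_form \<psi>'"
    and "\<phi> + \<i> *s \<psi> = \<phi>' + \<i> *s \<psi>'"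
  shows "\<phi> = \<phi>'" "\<psi> = \<psi>'"
  using real_imaginary_parts[of \<phi> \<psi>] real_imaginary_parts[of \<phi>' \<psi>'] assms by simp_all


section \<open>The family as a rotation\<close>

definition P_form :: "real \<Rightarrow> ix form" where
  "P_form t = basis_form {I2, I3} + (4 * t\<^sup>2) *\<^sub>R basis_form {I5, I6}"

definition Q_form :: "real \<Rightarrow> ix form" where
  "Q_form t = (2 * t) *\<^sub>R (basis_form {I2, I5} - basis_form {I3, I6})"

definition Re_Omega :: "real \<Rightarrow> real \<Rightarrow> ix form" where
  "Re_Omega t \<theta> = cos \<theta> *\<^sub>R Q_form t - sin \<theta> *\<^sub>R P_form t"

definition Im_Omega :: "real \<Rightarrow> ix form" where
  "Im_Omega t = (2 * t) *\<^sub>R (basis_form {I2, I6} + basis_form {I3, I5})"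

lemma of_real_cos_sin: "(complex_of_real (cos \<theta>))\<^sup>2 + (complex_of_real (sin \<theta>))\<^sup>2 = 1"
  by (metis of_real_1 of_real_add of_real_power sin_cos_squared_add2)

lemma beta_14: "\<beta> I1 \<^bold>\<and> \<beta> I4 = basis_form {I1, I4}"
  by (simp add: form_expand)

lemma omega_hat_rotation: "omega_hat t \<theta> = cos \<theta> *\<^sub>R P_form t + sin \<theta> *\<^sub>R Q_form t"
  unfolding omega_hat_def F_fam_def P_form_def Q_form_def
  by (simp add: form_expand mult_ac)

lemma F_fam_rotation: "F_fam t \<theta> = basis_form {I1, I4} + cos \<theta> *\<^sub>R P_form t + sin \<theta> *\<^sub>R Q_form t"
  using omega_hat_rotation[of t \<theta>] by (simp add: omega_hat_def beta_14 algebra_simps)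

lemma Omega_hat_Re_Im: "Omega_hat t \<theta> = Re_Omega t \<theta> + \<i> *s Im_Omega t"
  unfolding Omega_hat_def Re_Omega_def Im_Omega_def P_form_def Q_form_def
  apply (simp add: form_expand)
  apply (rule form_eqI)
  apply simp
  subgoal for S
    using of_real_cos_sin[of \<theta>] i_squared by algebra
  done

lemma Psi_fam_eq_wedge: "Psi_fam t \<theta> = alpha_hat \<^bold>\<and> Omega_hat t \<theta>"
  by (simp add: Psi_fam_def alpha_hat_def Omega_hat_def)

lemmas fam_unfold = F_fam_rotation Psi_fam_eq_wedge Omega_hat_Re_Im alpha_hat_def
  Re_Omega_def Im_Omega_def P_form_def Q_form_def

lemma real_form_P_Q: "real_form (P_form t)" "real_form (Q_form t)"
  by (simp_all add: P_form_def Q_form_def real_form_simps)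

lemma real_form_Omega: "real_form (Re_Omega t \<theta>)" "real_form (Im_Omega t)"
  by (simp_all add: Re_Omega_def Im_Omega_def real_form_simps real_form_P_Q)

lemma real_form_omega_hat: "real_form (omega_hat t \<theta>)"
  by (simp add: omega_hat_rotation real_form_simps real_form_P_Q)

lemma Re_Psi_fam: "form_Re (Psi_fam t \<theta>) = \<beta> I1 \<^bold>\<and> Re_Omega t \<theta> - \<beta> I4 \<^bold>\<and> Im_Omega t"
proof -
  have eq: "Psi_fam t \<theta> = (\<beta> I1 \<^bold>\<and> Re_Omega t \<theta> - \<beta> I4 \<^bold>\<and> Im_Omega t)
      + \<i> *s (\<beta> I1 \<^bold>\<and> Im_Omega t + \<beta> I4 \<^bold>\<and> Re_Omega t \<theta>)"
    unfolding Psi_fam_eq_wedge Omega_hat_Re_Im alpha_hat_def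
    by (simp add: wedge_add_left wedge_add_right wedge_smult_left wedge_smult_right)
  show ?thesis
    unfolding eq by (rule real_imaginary_parts) (simp_all add: real_form_simps real_form_wedge real_form_Omega)
qed


section \<open>Differentials\<close>

lemma d_basis_56_nonzero: "CE_diff h6 (basis_form {I5, I6}) \<noteq> 0"
  and beta_4_wedge_d_basis_56_nonzero: "\<beta> I4 \<^bold>\<and> CE_diff h6 (basis_form {I5, I6}) \<noteq> 0"
proof -
  have "{I1, I2, I6} \<noteq> {I1, I3, I5}" "{I1, I2, I4, I6} \<noteq> {I1, I3, I4, I5}"
    by (auto simp: set_eq_iff)
  then have "CE_diff h6 (basis_form {I5, I6}) $ {I1, I2, I6} \<noteq> 0"
    and "(\<beta> I4 \<^bold>\<and> CE_diff h6 (basis_form {I5, I6})) $ {I1, I2, I4, I6} \<noteq> 0"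
    by (simp_all add: form_expand basis_form_nth)
  then show "CE_diff h6 (basis_form {I5, I6}) \<noteq> 0"
    and "\<beta> I4 \<^bold>\<and> CE_diff h6 (basis_form {I5, I6}) \<noteq> 0"
    by auto
qed

lemma d_P_form: "CE_diff h6 (P_form t) = (4 * t\<^sup>2) *\<^sub>R CE_diff h6 (basis_form {I5, I6})"
  unfolding P_form_def by (simp add: form_expand)

lemma d_Q_form: "CE_diff h6 (Q_form t) = 0"
  unfolding Q_form_def by (simp add: form_expand)

lemma d_omega_hat:
  "CE_diff h6 (omega_hat t \<theta>) = (4 * t\<^sup>2 * cos \<theta>) *\<^sub>R CE_diff h6 (basis_form {I5, I6})"
  by (simp add: omega_hat_rotation CE_diff_add CE_diff_scaleR d_P_form d_Q_form mult_ac)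

lemma d_Re_Omega:
  "CE_diff h6 (Re_Omega t \<theta>) = - (4 * t\<^sup>2 * sin \<theta>) *\<^sub>R CE_diff h6 (basis_form {I5, I6})"
  by (simp add: Re_Omega_def CE_diff_diff CE_diff_scaleR d_P_form d_Q_form mult_ac)

lemma d_Im_Omega: "CE_diff h6 (Im_Omega t) = 0"
  unfolding Im_Omega_def by (simp add: form_expand)

lemma d_beta_4_wedge_Im_Omega: "CE_diff h6 (\<beta> I4 \<^bold>\<and> Im_Omega t) = 0"
  unfolding Im_Omega_def by (simp add: form_expand)

lemma d_basis_56_wedge_beta_1: "CE_diff h6 (basis_form {I5, I6}) \<^bold>\<and> \<beta> I1 = 0"
  and beta_1_wedge_beta_4_wedge_d_basis_56: "\<beta> I1 \<^bold>\<and> \<beta> I4 \<^bold>\<and> CE_diff h6 (basis_form {I5, I6}) = 0"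
  by (simp_all add: form_expand)

lemma d_F_wedge_F: "CE_diff h6 (F_fam t \<theta> \<^bold>\<and> F_fam t \<theta>) = 0"
  unfolding fam_unfold by (simp add: form_expand)

lemma d_Re_Psi: "CE_diff h6 (form_Re (Psi_fam t \<theta>)) = 0"
  unfolding Re_Psi_fam Re_Omega_def Im_Omega_def P_form_def Q_form_def by (simp add: form_expand)


section \<open>The family consists of half-flat structures\<close>

text \<open>The complex structure for which \<open>\<beta>\<^sup>1 + i \<beta>\<^sup>4\<close> and the two factors of \<open>\<Omega>\<close> are of type (1,0),
  solved for the components of \<open>J X\<close>; see \<open>J_coframe\<close> for its action on the coframe.\<close>

definition J_fam :: "real \<Rightarrow> real \<Rightarrow> real ^ ix \<Rightarrow> real ^ ix" where
  "J_fam t \<theta> X = (\<chi> k. case k of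
      I1 \<Rightarrow> - X $ I4
    | I2 \<Rightarrow> - (cos \<theta> * X $ I3 + 2 * t * sin \<theta> * X $ I5)
    | I3 \<Rightarrow> cos \<theta> * X $ I2 + 2 * t * sin \<theta> * X $ I6
    | I4 \<Rightarrow> X $ I1
    | I5 \<Rightarrow> sin \<theta> * X $ I2 / (2 * t) - cos \<theta> * X $ I6
    | I6 \<Rightarrow> cos \<theta> * X $ I5 - sin \<theta> * X $ I3 / (2 * t))"

text \<open>The metric for which the coframe is orthonormal.\<close>

definition g_fam :: "real \<Rightarrow> real \<Rightarrow> real ^ ix \<Rightarrow> real ^ ix \<Rightarrow> real" where
  "g_fam t \<theta> X Y = X $ I1 * Y $ I1 + X $ I4 * Y $ I4 + X $ I2 * Y $ I2
     + (cos \<theta> * X $ I3 + 2 * t * sin \<theta> * X $ I5) * (cos \<theta> * Y $ I3 + 2 * t * sin \<theta> * Y $ I5)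
     + (2 * t * cos \<theta> * X $ I5 - sin \<theta> * X $ I3) * (2 * t * cos \<theta> * Y $ I5 - sin \<theta> * Y $ I3)
     + (2 * t * X $ I6) * (2 * t * Y $ I6)"

lemma vec_ix_eqI:
  assumes "X $ I1 = Y $ I1" "X $ I2 = Y $ I2" "X $ I3 = Y $ I3"
    "X $ I4 = Y $ I4" "X $ I5 = Y $ I5" "X $ I6 = Y $ I6"
  shows "X = Y"
  unfolding vec_eq_iff
proof
  show "X $ i = Y $ i" for i
    using assms by (cases i) simp_all
qed

text \<open>Precomposition with \<open>J\<close> sends the real part of each (1,0)-form to minus its imaginary part,
  and the imaginary part to the real part. Rewriting with these equations keeps the division by
  \<open>t\<close> in \<open>J\<close> out of the computations with the metric and with forms.\<close>

lemma J_coframe: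
  assumes "t \<noteq> 0"
  shows "cos \<theta> * J_fam t \<theta> X $ I3 + 2 * t * sin \<theta> * J_fam t \<theta> X $ I5 = X $ I2"
    and "2 * t * cos \<theta> * J_fam t \<theta> X $ I5 - sin \<theta> * J_fam t \<theta> X $ I3 = - (2 * t * X $ I6)"
    and "2 * t * J_fam t \<theta> X $ I6 = 2 * t * cos \<theta> * X $ I5 - sin \<theta> * X $ I3"
    and "J_fam t \<theta> X $ I2 = - (cos \<theta> * X $ I3 + 2 * t * sin \<theta> * X $ I5)"
    and "J_fam t \<theta> X $ I1 = - X $ I4" and "J_fam t \<theta> X $ I4 = X $ I1"
proof -
  note cs = sin_cos_squared_add[of \<theta>]
  show "cos \<theta> * J_fam t \<theta> X $ I3 + 2 * t * sin \<theta> * J_fam t \<theta> X $ I5 = X $ I2"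
    using assms apply (simp add: J_fam_def field_simps) using cs by algebra
  show "2 * t * cos \<theta> * J_fam t \<theta> X $ I5 - sin \<theta> * J_fam t \<theta> X $ I3 = - (2 * t * X $ I6)"
    using assms apply (simp add: J_fam_def field_simps) using cs by algebra
qed (use assms in \<open>simp_all add: J_fam_def field_simps\<close>)

text \<open>The coframe is a basis of the dual space: the rotation by \<open>\<theta>\<close> is undone to recover the
  components 3 and 5.\<close>

lemma coframe_injective:
  fixes X Y :: "real ^ ix" and t \<theta> :: real
  assumes "t \<noteq> 0" "X $ I1 = Y $ I1" "X $ I4 = Y $ I4" "X $ I2 = Y $ I2" "X $ I6 = Y $ I6"
    and f: "cos \<theta> * X $ I3 + 2 * t * sin \<theta> * X $ I5 = cos \<theta> * Y $ I3 + 2 * t * sin \<theta> * Y $ I5"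
    and e: "2 * t * cos \<theta> * X $ I5 - sin \<theta> * X $ I3 = 2 * t * cos \<theta> * Y $ I5 - sin \<theta> * Y $ I3"
  shows "X = Y"
proof -
  have "X $ I3 = Y $ I3"
    using f e sin_cos_squared_add[of \<theta>] by algebra
  moreover have "2 * t * X $ I5 = 2 * t * Y $ I5"
    using f e sin_cos_squared_add[of \<theta>] by algebra
  ultimately show ?thesis
    using assms by (intro vec_ix_eqI) auto
qed

lemma inner_prod_g_fam:
  assumes "t \<noteq> 0"
  shows "inner_prod (g_fam t \<theta>)"
  unfolding inner_prod_def
proof (intro conjI allI impI)
  show "bilinear (g_fam t \<theta>)"
    unfolding bilinear_def
    by (intro conjI allI linearI) (simp_all add: g_fam_def algebra_simps)
  show "g_fam t \<theta> X Y = g_fam t \<theta> Y X" for X Y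
    by (simp add: g_fam_def mult.commute)
  show "g_fam t \<theta> X X > 0" if "X \<noteq> 0" for X
  proof (rule ccontr)
    let ?f = "cos \<theta> * X $ I3 + 2 * t * sin \<theta> * X $ I5"
    let ?e = "2 * t * cos \<theta> * X $ I5 - sin \<theta> * X $ I3"
    assume "\<not> g_fam t \<theta> X X > 0"
    then have "(X $ I1)\<^sup>2 + (X $ I4)\<^sup>2 + (X $ I2)\<^sup>2 + ?f\<^sup>2 + ?e\<^sup>2 + (2 * t * X $ I6)\<^sup>2 \<le> 0"
      by (simp only: g_fam_def power2_eq_square not_less)
    moreover have "(X $ I1)\<^sup>2 \<ge> 0" "(X $ I4)\<^sup>2 \<ge> 0" "(X $ I2)\<^sup>2 \<ge> 0" "?f\<^sup>2 \<ge> 0" "?e\<^sup>2 \<ge> 0" "(2 * t * X $ I6)\<^sup>2 \<ge> 0"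
      by (rule zero_le_power2)+
    ultimately have "(X $ I1)\<^sup>2 = 0" "(X $ I4)\<^sup>2 = 0" "(X $ I2)\<^sup>2 = 0" "?f\<^sup>2 = 0" "?e\<^sup>2 = 0" "(2 * t * X $ I6)\<^sup>2 = 0"
      by linarith+
    then have "X = 0"
      using assms by (intro coframe_injective[of t X 0 \<theta>]) auto
    with that show False by simp
  qed
qed

lemma almost_hermitian_fam:
  assumes "t \<noteq> 0"
  shows "almost_hermitian (J_fam t \<theta>) (g_fam t \<theta>)"
  unfolding almost_hermitian_def
proof (intro conjI allI)
  show "linear (J_fam t \<theta>)"
    by (intro linearI vec_ix_eqI)
      (simp_all add: J_fam_def distrib_left add_divide_distrib right_diff_distrib mult.left_commute)
  show "J_fam t \<theta> (J_fam t \<theta> X) = - X" for X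
  proof (rule coframe_injective[OF assms, where \<theta> = \<theta>])
    have "2 * t * J_fam t \<theta> (J_fam t \<theta> X) $ I6 = 2 * t * (- X) $ I6"
      by (simp only: J_coframe[OF assms]) simp
    then show "J_fam t \<theta> (J_fam t \<theta> X) $ I6 = (- X) $ I6"
      using assms by (simp only: mult_cancel_left) simp
  qed (simp_all only: J_coframe[OF assms], simp_all)
  show "inner_prod (g_fam t \<theta>)"
    by (rule inner_prod_g_fam[OF assms])
  show "g_fam t \<theta> (J_fam t \<theta> X) (J_fam t \<theta> Y) = g_fam t \<theta> X Y" for X Y
    unfolding g_fam_def J_coframe[OF assms] by (simp add: algebra_simps)
qed

lemma greaterThan_ix:
  "{I1<..} = {I2, I3, I4, I5, I6}" "{I2<..} = {I3, I4, I5, I6}" "{I3<..} = {I4, I5, I6}"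
  "{I4<..} = {I5, I6}" "{I5<..} = {I6}" "{I6<..} = {}"
  by (auto simp: less_ix_def, (case_tac x; simp)+)

lemma fundamental_form_fam:
  assumes "t \<noteq> 0"
  shows "fundamental_form (J_fam t \<theta>) (g_fam t \<theta>) (F_fam t \<theta>)"
  unfolding fundamental_form_def
proof (intro conjI allI)
  show "homogeneous 2 (F_fam t \<theta>)"
    by (auto simp: homogeneous_def F_fam_rotation P_form_def Q_form_def basis_form_nth)
  show "eval2 (F_fam t \<theta>) X Y = complex_of_real (g_fam t \<theta> (J_fam t \<theta> X) Y)" for X Y
  proof -
    have "eval2 (F_fam t \<theta>) X Y = of_real ((X $ I1 * Y $ I4 - X $ I4 * Y $ I1)
      + cos \<theta> * (X $ I2 * Y $ I3 - X $ I3 * Y $ I2)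
      + 2 * t * sin \<theta> * (X $ I2 * Y $ I5 - X $ I5 * Y $ I2)
      - 2 * t * sin \<theta> * (X $ I3 * Y $ I6 - X $ I6 * Y $ I3)
      + 4 * t\<^sup>2 * cos \<theta> * (X $ I5 * Y $ I6 - X $ I6 * Y $ I5))"
      by (simp add: eval2_def UNIV_ix greaterThan_ix F_fam_rotation P_form_def Q_form_def scaleR_form
          basis_form_nth doubleton_eq_iff algebra_simps)
    also have "\<dots> = complex_of_real (g_fam t \<theta> (J_fam t \<theta> X) Y)"
      unfolding g_fam_def J_coframe[OF assms]
      by (rule arg_cong[of _ _ complex_of_real]) (simp add: algebra_simps power2_eq_square)
    finally show ?thesis .
  qed
qed

lemma form_30_fam:
  assumes "t \<noteq> 0"
  shows "form_30 (J_fam t \<theta>) (Psi_fam t \<theta>)"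
proof -
  let ?b = "\<beta> I2 + \<i> *s (cos \<theta> *\<^sub>R \<beta> I3) + \<i> *s ((2 * t * sin \<theta>) *\<^sub>R \<beta> I5)"
  let ?c = "- (sin \<theta> *\<^sub>R \<beta> I3) + (2 * t * cos \<theta>) *\<^sub>R \<beta> I5 + \<i> *s ((2 * t) *\<^sub>R \<beta> I6)"
  have hom: "homogeneous 1 alpha_hat" "homogeneous 1 ?b" "homogeneous 1 ?c"
    by (auto simp: homogeneous_def alpha_hat_def basis_form_nth)
  have ev: "eval1 alpha_hat X = Complex (X $ I1) (X $ I4)"
    "eval1 ?b X = Complex (X $ I2) (cos \<theta> * X $ I3 + 2 * t * sin \<theta> * X $ I5)"
    "eval1 ?c X = Complex (2 * t * cos \<theta> * X $ I5 - sin \<theta> * X $ I3) (2 * t * X $ I6)" for X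
    by (simp_all add: eval1_def UNIV_ix alpha_hat_def basis_form_nth complex_eq_iff)
  have "form_10 (J_fam t \<theta>) alpha_hat" "form_10 (J_fam t \<theta>) ?b" "form_10 (J_fam t \<theta>) ?c"
    unfolding form_10_def using hom
    by (simp_all only: ev J_coframe[OF assms]) (simp_all add: complex_eq_iff)
  then show ?thesis
    unfolding form_30_def Psi_fam_def alpha_hat_def[symmetric] by (intro span_base) blast
qed

text \<open>The product has type (4,1), so it vanishes in complex dimension 3; the expansion into basis
  forms confirms this directly.\<close>

lemma F_wedge_Psi: "F_fam t \<theta> \<^bold>\<and> Psi_fam t \<theta> = 0"
  unfolding fam_unfold
  by (simp add: form_expand) (simp add: vec_eq_iff power2_eq_square algebra_simps)

text \<open>Both sides of the normalisation are \<open>8 f\<^sup>1 \<and> \<dots> \<and> f\<^sup>6\<close> in terms of the coframe \<open>f\<close>, whose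
  determinant is \<open>4t\<^sup>2\<close>.\<close>

lemma F_cubed:
  "(4/3) *\<^sub>R (F_fam t \<theta> \<^bold>\<and> F_fam t \<theta> \<^bold>\<and> F_fam t \<theta>) = (32 * t\<^sup>2) *\<^sub>R basis_form UNIV"
  unfolding fam_unfold UNIV_ix
  apply (simp add: form_expand)
  apply (rule form_eqI)
  apply simp
  subgoal for S
    using of_real_cos_sin[of \<theta>] i_squared by algebra
  done

lemma Psi_wedge_cnj_Psi:
  "\<i> *s (Psi_fam t \<theta> \<^bold>\<and> form_cnj (Psi_fam t \<theta>)) = (32 * t\<^sup>2) *\<^sub>R basis_form UNIV"
  unfolding fam_unfold UNIV_ix
  apply (simp add: form_expand form_cnj_simps)
  apply (rule form_eqI)
  apply simp
  subgoal for S
    using of_real_cos_sin[of \<theta>] i_squared by algebra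
  done

lemma half_flat_fam:
  assumes "t \<noteq> 0"
  shows "half_flat h6 (F_fam t \<theta>) (Psi_fam t \<theta>)"
proof -
  have "basis_form (UNIV :: ix set) \<noteq> 0"
    by (auto simp: vec_eq_iff basis_form_nth)
  then have "SU3_structure (F_fam t \<theta>) (Psi_fam t \<theta>)"
    unfolding SU3_structure_def F_cubed Psi_wedge_cnj_Psi
    using almost_hermitian_fam[OF assms] fundamental_form_fam[OF assms] form_30_fam[OF assms]
      F_wedge_Psi assms by (intro conjI) (blast | simp)+
  then show ?thesis
    by (simp add: half_flat_def d_F_wedge_F d_Re_Psi)
qed


section \<open>Exactly which members solve the SUSY equations\<close>

lemma solves_IIA_iff:
  assumes "t \<noteq> 0"
  shows "solves_IIA t \<theta> \<longleftrightarrow> cos \<theta> = 0"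
proof
  assume "solves_IIA t \<theta>"
  then obtain kp ko :: real and \<alpha> RO_o where k: "0 < kp" "0 < ko"
    and a: "form_Re \<alpha> + (\<i> * complex_of_real kp) *s form_Im \<alpha> = alpha_hat"
    and w: "(1 / ko) *\<^sub>R RO_o = omega_hat t \<theta>"
    and d: "CE_diff h6 RO_o = (kp * ko) *\<^sub>R (form_Re \<alpha> \<^bold>\<and> CE_diff h6 (form_Im \<alpha>))"
    unfolding solves_IIA_def SUSY_IIA_def by blast
  have "form_Re \<alpha> + \<i> *s (kp *\<^sub>R form_Im \<alpha>) = \<beta> I1 + \<i> *s \<beta> I4"
    using a by (simp add: alpha_hat_def scaleR_form)
  then have "kp *\<^sub>R form_Im \<alpha> = \<beta> I4"
    by (rule real_imaginary_unique(2)[rotated 4]) (simp_all add: real_form_simps)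
  then have "kp *\<^sub>R CE_diff h6 (form_Im \<alpha>) = 0"
    by (metis CE_diff_scaleR h6_structure_equations(4))
  with k d have "CE_diff h6 RO_o = 0"
    by (simp add: wedge_zero_right)
  with w have "CE_diff h6 (omega_hat t \<theta>) = 0"
    by (metis CE_diff_scaleR scaleR_zero_right)
  then show "cos \<theta> = 0"
    using assms d_basis_56_nonzero by (simp add: d_omega_hat)
next
  assume c: "cos \<theta> = 0"
  \<comment> \<open>Any admissible pair of constants would do; \<open>3/5\<close> and \<open>4/5\<close> are rational.\<close>
  let ?\<alpha> = "\<beta> I1 + \<i> *s ((5/3) *\<^sub>R \<beta> I4)"
  have \<alpha>: "form_Re ?\<alpha> = \<beta> I1" "form_Im ?\<alpha> = (5/3) *\<^sub>R \<beta> I4"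
    by (simp_all add: real_imaginary_parts real_form_simps)
  have a: "form_Re ?\<alpha> + (\<i> * complex_of_real (3/5)) *s form_Im ?\<alpha> = alpha_hat"
    unfolding \<alpha> by (simp add: alpha_hat_def scaleR_form)
  have Om: "Re_Omega t \<theta> - (\<i> * complex_of_real (1 / (3/5))) *s ((- 3/5) *\<^sub>R Im_Omega t) = Omega_hat t \<theta>"
    by (simp add: Omega_hat_Re_Im scaleR_form)
  show "solves_IIA t \<theta>"
    unfolding solves_IIA_def SUSY_IIA_def
  proof (rule exI[of _ "3/5"], rule exI[of _ "4/5"], intro conjI, goal_cases)
    case 6
    show ?case
    proof (rule exI[of _ ?\<alpha>], rule exI[of _ "(- 3/5) *\<^sub>R Im_Omega t"],
        rule exI[of _ "(4/5) *\<^sub>R omega_hat t \<theta>"], rule exI[of _ "Re_Omega t \<theta>"],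
        rule exI[of _ "(4/3) *\<^sub>R CE_diff h6 (Re_Omega t \<theta>)"], intro conjI, goal_cases)
      case 4 show ?case by (rule a)
    next
      case 6 show ?case by (rule Om)
    qed (simp_all only: \<alpha>, simp_all add: real_form_simps real_form_Omega real_form_omega_hat
        CE_diff_scaleR wedge_scaleR_left wedge_scaleR_right h6_structure_equations
        d_omega_hat c wedge_zero_right wedge_minus_left wedge_minus_right
        CE_diff_minus d_Re_Omega d_basis_56_wedge_beta_1 d_beta_4_wedge_Im_Omega)
  qed (simp_all add: power2_eq_square)
qed

lemma solves_IIB_iff:
  assumes "t \<noteq> 0"
  shows "solves_IIB t \<theta> \<longleftrightarrow> sin \<theta> = 0"
proof
  assume "solves_IIB t \<theta>"
  then obtain kp ko :: real and \<alpha> RO_o IO H where k: "0 < kp" "0 < ko"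
    and r: "real_form RO_o" "real_form IO"
    and a: "kp *\<^sub>R form_Re \<alpha> + \<i> *s form_Im \<alpha> = alpha_hat"
    and Om: "(1 / kp) *\<^sub>R RO_o + \<i> *s IO = Omega_hat t \<theta>"
    and H: "kp *\<^sub>R H = ko *\<^sub>R CE_diff h6 IO"
    and e: "form_Re \<alpha> \<^bold>\<and> H = - (ko / kp) *\<^sub>R (form_Im \<alpha> \<^bold>\<and> CE_diff h6 RO_o)"
    unfolding solves_IIB_def SUSY_IIB_def by blast
  have \<alpha>: "form_Im \<alpha> = \<beta> I4"
    using a unfolding alpha_hat_def
    by (rule real_imaginary_unique(2)[rotated 4]) (simp_all add: real_form_simps)
  have RO: "(1 / kp) *\<^sub>R RO_o = Re_Omega t \<theta>"
    using Om unfolding Omega_hat_Re_Im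
    by (rule real_imaginary_unique(1)[rotated 4]) (simp_all add: real_form_simps r real_form_Omega)
  have IO: "IO = Im_Omega t"
    using Om unfolding Omega_hat_Re_Im
    by (rule real_imaginary_unique(2)[rotated 4]) (simp_all add: real_form_simps r real_form_Omega)
  have "H = 0"
    using H k by (simp add: IO d_Im_Omega)
  with e k have "\<beta> I4 \<^bold>\<and> CE_diff h6 RO_o = 0"
    by (simp add: \<alpha> wedge_zero_right)
  then have "\<beta> I4 \<^bold>\<and> CE_diff h6 (Re_Omega t \<theta>) = 0"
    by (simp add: RO[symmetric] CE_diff_scaleR wedge_scaleR_right)
  then show "sin \<theta> = 0"
    using assms beta_4_wedge_d_basis_56_nonzero
    by (simp add: d_Re_Omega wedge_scaleR_right wedge_minus_right)
next
  assume s: "sin \<theta> = 0"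
  let ?\<alpha> = "(5/3) *\<^sub>R \<beta> I1 + \<i> *s \<beta> I4"
  have \<alpha>: "form_Re ?\<alpha> = (5/3) *\<^sub>R \<beta> I1" "form_Im ?\<alpha> = \<beta> I4"
    by (simp_all add: real_imaginary_parts real_form_simps)
  show "solves_IIB t \<theta>"
    unfolding solves_IIB_def SUSY_IIB_def
  proof (rule exI[of _ "3/5"], rule exI[of _ "4/5"], intro conjI, goal_cases)
    case 6
    show ?case
    proof (rule exI[of _ ?\<alpha>], rule exI[of _ "(4/5) *\<^sub>R omega_hat t \<theta>"],
        rule exI[of _ "(3/5) *\<^sub>R Re_Omega t \<theta>"], rule exI[of _ "Im_Omega t"],
        rule exI[of _ "0"], intro conjI)
    qed (simp_all only: \<alpha>, simp_all add: real_form_simps real_form_Omega real_form_omega_hat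
        alpha_hat_def Omega_hat_Re_Im CE_diff_scaleR wedge_scaleR_left wedge_scaleR_right
        h6_structure_equations d_omega_hat d_Re_Omega d_Im_Omega s wedge_zero_left wedge_zero_right
        beta_1_wedge_beta_4_wedge_d_basis_56)
  qed (simp_all add: power2_eq_square)
qed


section \<open>Smooth curves in the family\<close>

lemma smooth_curve_trig:
  fixes A B C :: "'a::real_normed_vector"
  shows "smooth_curve_on I (\<lambda>s. A + cos (p + q * s) *\<^sub>R B + sin (p + q * s) *\<^sub>R C)"
proof -
  \<comment> \<open>Differentiating \<open>cos\<close> or \<open>sin\<close> shifts its argument by \<open>\<pi>/2\<close>, so all derivatives have the
    same shape; only the zeroth one carries the constant term.\<close>
  define D where "D n s = (if n = 0 then A else 0) +
      (q ^ n * cos (p + q * s + real n * (pi / 2))) *\<^sub>R B + (q ^ n * sin (p + q * s + real n * (pi / 2))) *\<^sub>R C"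
    for n :: nat and s :: real
  have "(D n has_vector_derivative D (Suc n) s) (at s within I)" for n s
  proof -
    have shift: "p + q * s + real (Suc n) * (pi / 2) = p + q * s + real n * (pi / 2) + pi / 2"
      by (simp add: algebra_simps add_divide_distrib)
    have "q ^ Suc n * cos (y + pi / 2) = q ^ n * (- sin y * q)"
      and "q ^ Suc n * sin (y + pi / 2) = q ^ n * (cos y * q)" for y :: real
      by (simp_all add: cos_add sin_add)
    then have D_Suc: "D (Suc n) s = (q ^ n * (- sin (p + q * s + real n * (pi / 2)) * q)) *\<^sub>R B
        + (q ^ n * (cos (p + q * s + real n * (pi / 2)) * q)) *\<^sub>R C"
      by (simp only: D_def shift) simp
    show ?thesis
      unfolding D_Suc unfolding D_def
      by (auto intro!: derivative_eq_intros simp: has_real_derivative_iff_has_vector_derivative[symmetric] mult_ac)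
  qed
  moreover have "D 0 = (\<lambda>s. A + cos (p + q * s) *\<^sub>R B + sin (p + q * s) *\<^sub>R C)"
    by (simp add: D_def fun_eq_iff)
  ultimately show ?thesis
    unfolding smooth_curve_on_def by blast
qed

lemma smooth_curve_fam: "smooth_curve_on I (\<lambda>s. (F_fam t (p + q * s), Psi_fam t (p + q * s)))"
proof -
  let ?A = "(basis_form {I1, I4}, alpha_hat \<^bold>\<and> (\<i> *s Im_Omega t))"
  let ?B = "(P_form t, alpha_hat \<^bold>\<and> Q_form t)"
  let ?C = "(Q_form t, - (alpha_hat \<^bold>\<and> P_form t))"
  have "(F_fam t \<theta>, Psi_fam t \<theta>) = ?A + cos \<theta> *\<^sub>R ?B + sin \<theta> *\<^sub>R ?C" for \<theta>
    unfolding F_fam_rotation Psi_fam_eq_wedge Omega_hat_Re_Im Re_Omega_def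
    by (simp add: wedge_add_right wedge_scaleR_right wedge_diff_right)
  then show ?thesis
    using smooth_curve_trig[of I ?A p q ?B ?C] by simp
qed


section \<open>Instability\<close>

theorem proposition4p1:
  fixes t :: real
  assumes "t \<noteq> 0"
  shows "(\<forall>\<theta>. half_flat h6 (F_fam t \<theta>) (Psi_fam t \<theta>)) \<and>
    (\<forall>\<theta>. 0 < \<theta> \<and> \<theta> < pi / 2 \<longrightarrow> \<not> solves_IIA t \<theta> \<and> \<not> solves_IIB t \<theta>) \<and>
    (\<exists>\<gamma> :: real \<Rightarrow> real.
       smooth_curve_on {0..1} (\<lambda>s. (F_fam t (\<gamma> s), Psi_fam t (\<gamma> s))) \<and>
       (\<forall>s\<in>{0..1}. half_flat h6 (F_fam t (\<gamma> s)) (Psi_fam t (\<gamma> s))) \<and>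
       solves_IIA t (\<gamma> 0) \<and>
       (\<exists>\<epsilon>>0. \<forall>s\<in>{0..1}. 0 < s \<and> s < \<epsilon> \<longrightarrow> \<not> solves_IIA t (\<gamma> s))) \<and>
    (\<exists>\<gamma> :: real \<Rightarrow> real.
       smooth_curve_on {0..1} (\<lambda>s. (F_fam t (\<gamma> s), Psi_fam t (\<gamma> s))) \<and>
       (\<forall>s\<in>{0..1}. half_flat h6 (F_fam t (\<gamma> s)) (Psi_fam t (\<gamma> s))) \<and>
       solves_IIB t (\<gamma> 0) \<and>
       (\<exists>\<epsilon>>0. \<forall>s\<in>{0..1}. 0 < s \<and> s < \<epsilon> \<longrightarrow> \<not> solves_IIB t (\<gamma> s)))"
proof (intro conjI)
  show "\<forall>\<theta>. half_flat h6 (F_fam t \<theta>) (Psi_fam t \<theta>)"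
    using half_flat_fam[OF assms] by blast
  have pos: "cos \<theta> \<noteq> 0" "sin \<theta> \<noteq> 0" if "0 < \<theta>" "\<theta> < pi / 2" for \<theta> :: real
    using cos_gt_zero[OF that] sin_gt_zero[of \<theta>] that by simp_all
  then show "\<forall>\<theta>. 0 < \<theta> \<and> \<theta> < pi / 2 \<longrightarrow> \<not> solves_IIA t \<theta> \<and> \<not> solves_IIB t \<theta>"
    using solves_IIA_iff[OF assms] solves_IIB_iff[OF assms] by blast
  have "1 < pi / 2"
    using pi_gt3 by simp
  \<comment> \<open>Since \<open>1 < \<pi>/2\<close>, both curves below stay in the open interval at all parameters in
    \<open>(0, 1)\<close>, so \<open>1\<close> serves as the bound.\<close>
  let ?\<gamma> = "\<lambda>s. pi / 2 + (- 1) * s :: real"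
  have "solves_IIA t (?\<gamma> 0)"
    by (simp add: solves_IIA_iff[OF assms])
  moreover have "\<not> solves_IIA t (?\<gamma> s)" if "0 < s" "s < 1" for s
    using pos(1)[of "?\<gamma> s"] that \<open>1 < pi / 2\<close> by (simp add: solves_IIA_iff[OF assms])
  ultimately show "\<exists>\<gamma> :: real \<Rightarrow> real.
       smooth_curve_on {0..1} (\<lambda>s. (F_fam t (\<gamma> s), Psi_fam t (\<gamma> s))) \<and>
       (\<forall>s\<in>{0..1}. half_flat h6 (F_fam t (\<gamma> s)) (Psi_fam t (\<gamma> s))) \<and>
       solves_IIA t (\<gamma> 0) \<and>
       (\<exists>\<epsilon>>0. \<forall>s\<in>{0..1}. 0 < s \<and> s < \<epsilon> \<longrightarrow> \<not> solves_IIA t (\<gamma> s))"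
    using smooth_curve_fam[of "{0..1}" t "pi / 2" "- 1"] half_flat_fam[OF assms]
    by (intro exI[of _ ?\<gamma>] conjI exI[of _ "1::real"]) auto
  let ?\<delta> = "\<lambda>s. 0 + 1 * s :: real"
  have "solves_IIB t (?\<delta> 0)"
    by (simp add: solves_IIB_iff[OF assms])
  moreover have "\<not> solves_IIB t (?\<delta> s)" if "0 < s" "s < 1" for s
    using pos(2)[of s] that \<open>1 < pi / 2\<close> by (simp add: solves_IIB_iff[OF assms])
  ultimately show "\<exists>\<gamma> :: real \<Rightarrow> real.
       smooth_curve_on {0..1} (\<lambda>s. (F_fam t (\<gamma> s), Psi_fam t (\<gamma> s))) \<and>
       (\<forall>s\<in>{0..1}. half_flat h6 (F_fam t (\<gamma> s)) (Psi_fam t (\<gamma> s))) \<and>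
       solves_IIB t (\<gamma> 0) \<and>
       (\<exists>\<epsilon>>0. \<forall>s\<in>{0..1}. 0 < s \<and> s < \<epsilon> \<longrightarrow> \<not> solves_IIB t (\<gamma> s))"
    using smooth_curve_fam[of "{0..1}" t 0 1] half_flat_fam[OF assms]
    by (intro exI[of _ ?\<delta>] conjI exI[of _ "1::real"]) auto
qed

end
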